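(* Let $k\ge 1$, $N\ge 1$ and $\varrho\in(1,2]$, and let $A_1,\dots,A_k\subseteq\mathbb{N}$ be regular sets each satisfying conditions (i), (ii), (iii) (with this $\varrho$). Let $X=A_1\times\dots\times A_k\subseteq\mathbb{N}^k$ and let $F$ be the function defined on points $p=(p_1,\dots,p_k)\in\mathbb{N}^k$ with $1\le p_i\le N$ by $F(p)=1$ if $p\in FS(X)$ and $F(p)=0$ otherwise. Consider $k$ players $P_1,\dots,P_k$ in the number-in-hand blackboard model, where player $P_i$ knows only $p_i$ and the set $A_i$. Then $$CC^{(k)}(F)<k\log_2\Big(\frac{\log_2 N}{\log_2\varrho}\Big)+k.$$
   Context: $\mathbb{N}=\{1,2,3,\dots\}$. For $X\subseteq\mathbb{N}^k$, $FS(X)$ is the set of all sums $\sum_{x\in F}x$ over nonempty finite subsets $F\subseteq X$ (distinct elements, each used at most once). For a set $A=\{a_1<a_2<\dots\}\subseteq\mathbb{N}$ the conditions are: (i) $1\in A$; (ii) $A\setminus\{1\}\subseteq A+A$, where $A+A=\{a+b:a,b\in A\}$; (iii) $a_{j+1}>\varrho a_j$ for all $j$. A representation of $n\in\mathbb{N}$ from $A$ is an expression $n=\sum_i\varepsilon_i a_i$ with nonnegative integers $\varepsilon_i$, finitely many nonzero (repetitions allowed); its length is $\sum_i\varepsilon_i$ and its multiplicity is $\max_i\varepsilon_i$; $rank_A(n)$ is the minimal length of a representation. $A$ is regular if every $n\in\mathbb{N}$ has a representation of length $rank_A(n)$ with multiplicity $1$. Communication model: each player $P_i$ holds its input; players communicate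 by writing bits on a blackboard visible to all players; $CC^{(k)}(F)$ is the least number of bits that must be written (in the worst case) by a protocol after which all players know the value $F(p)$ correctly for every input. *)

theory Defs
  imports
    "HOL-Analysis.Finite_Cartesian_Product"
    "HOL-Library.Multiset"
    "HOL-Library.Extended_Real"
begin

section \<open>Finite sums and representations\<close>

definition FS :: "'a::comm_monoid_add set \<Rightarrow> 'a set" where
  "FS X = {\<Sum>F | F. finite F \<and> F \<noteq> {} \<and> F \<subseteq> X}"

definition product_set :: "('k::finite \<Rightarrow> nat set) \<Rightarrow> (nat ^ 'k) set" where
  "product_set A = {x. \<forall>i. x $ i \<in> A i}"

text \<open>
  The naturals of the source start at 1, so \<open>0 \<notin> A\<close> is part of the definition. The last conjunct
  quantifies over the pairs of consecutive elements \<open>a = a\<^sub>j\<close>, \<open>b = a\<^sub>j\<^sub>+\<^sub>1\<close> of \<open>A\<close>.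
\<close>

definition admissible :: "real \<Rightarrow> nat set \<Rightarrow> bool" where
  "admissible \<rho> A \<longleftrightarrow>
     0 \<notin> A \<and>
     1 \<in> A \<and>
     A - {1} \<subseteq> {a + b | a b. a \<in> A \<and> b \<in> A} \<and>
     (\<forall>a\<in>A. \<forall>b\<in>A. a < b \<and> A \<inter> {a<..<b} = {} \<longrightarrow> real b > \<rho> * real a)"

text \<open>
  A representation \<open>n = (\<Sum>i. \<epsilon>\<^sub>i * a\<^sub>i)\<close> is the multiset containing \<open>a\<^sub>i\<close> exactly \<open>\<epsilon>\<^sub>i\<close> times;
  its length is the size of the multiset.
\<close>

definition represents :: "nat set \<Rightarrow> nat multiset \<Rightarrow> nat \<Rightarrow> bool" where
  "represents A M n \<longleftrightarrow> set_mset M \<subseteq> A \<and> sum_mset M = n"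

definition mult_of :: "nat multiset \<Rightarrow> nat" where
  "mult_of M = Max (range (count M))"

definition rank_in :: "nat set \<Rightarrow> nat \<Rightarrow> nat" where
  "rank_in A n = (LEAST l. \<exists>M. represents A M n \<and> size M = l)"

definition regular :: "nat set \<Rightarrow> bool" where
  "regular A \<longleftrightarrow>
     (\<forall>n\<ge>1. \<exists>M. represents A M n \<and> size M = rank_in A n \<and> mult_of M = 1)"


section \<open>Number-in-hand blackboard protocols\<close>

text \<open>
  The players are the elements of the finite type \<open>'k\<close>, so there are \<open>CARD('k)\<close> of them. A node of
  a protocol tree stands for a state of the blackboard. At \<open>Write i g P Q\<close> player \<open>i\<close> writes the
  bit \<open>g\<close> of its own input, and the protocol goes on with \<open>P\<close> if this bit is 1 and with \<open>Q\<close> if it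
  is 0. At \<open>Stop h\<close> nothing more is written, and player \<open>i\<close> believes the value of the function to
  be \<open>h i\<close> of its own input; thus each player draws its conclusion from the blackboard and its own
  input.
\<close>

datatype ('k, 'x, 'o) protocol =
  Stop "'k \<Rightarrow> 'x \<Rightarrow> 'o"
| Write 'k "'x \<Rightarrow> bool" "('k, 'x, 'o) protocol" "('k, 'x, 'o) protocol"

primrec bits_written :: "('k::finite, 'x, 'o) protocol \<Rightarrow> 'x ^ 'k \<Rightarrow> nat" where
  "bits_written (Stop h) x = 0"
| "bits_written (Write i g P Q) x =
     Suc (if g (x $ i) then bits_written P x else bits_written Q x)"

primrec conclusion :: "('k::finite, 'x, 'o) protocol \<Rightarrow> 'x ^ 'k \<Rightarrow> 'k \<Rightarrow> 'o" where
  "conclusion (Stop h) x i = h i (x $ i)"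
| "conclusion (Write j g P Q) x i =
     (if g (x $ j) then conclusion P x i else conclusion Q x i)"

text \<open>\<open>D i\<close> is the set of possible inputs of player \<open>i\<close>.\<close>

definition inputs :: "('k::finite \<Rightarrow> 'x set) \<Rightarrow> ('x ^ 'k) set" where
  "inputs D = {x. \<forall>i. x $ i \<in> D i}"

definition computes ::
    "('k::finite, 'x, 'o) protocol \<Rightarrow> ('k \<Rightarrow> 'x set) \<Rightarrow> ('x ^ 'k \<Rightarrow> 'o) \<Rightarrow> bool" where
  "computes P D F \<longleftrightarrow> (\<forall>x\<in>inputs D. \<forall>i. conclusion P x i = F x)"

text \<open>The value is \<open>\<infinity>\<close> if no protocol computes \<open>F\<close>.\<close>

definition CC :: "('k::finite \<Rightarrow> 'x set) \<Rightarrow> ('x ^ 'k \<Rightarrow> 'o) \<Rightarrow> enat" where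
  "CC D F = (INF P \<in> {P. computes P D F}. SUP x \<in> inputs D. enat (bits_written P x))"


section \<open>The membership functions\<close>

definition FS_member :: "('k::finite \<Rightarrow> nat set) \<Rightarrow> nat ^ 'k \<Rightarrow> nat" where
  "FS_member A p = (if p \<in> FS (product_set A) then 1 else 0)"

text \<open>
  For fixed sets \<open>A i\<close>, a protocol for \<open>FS_member A\<close> may depend on all of them. That player \<open>i\<close>
  knows \<open>A i\<close> but not the other sets is expressed by making the set part of the player's input.
\<close>

definition set_point_inputs :: "real \<Rightarrow> nat \<Rightarrow> (nat set \<times> nat) set" where
  "set_point_inputs \<rho> N = {B. admissible \<rho> B \<and> regular B} \<times> {1..N}"

definition FS_member_joint :: "(nat set \<times> nat) ^ 'k::finite \<Rightarrow> nat" where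
  "FS_member_joint q = FS_member (\<lambda>i. fst (q $ i)) (\<chi> i. snd (q $ i))"

end

theory Submission
  imports Defs
begin

text \<open>
  A point \<open>p\<close> lies in \<open>FS (A\<^sub>1 \<times> \<dots> \<times> A\<^sub>k)\<close> iff \<open>rank p\<^sub>i \<le> p\<^sub>j\<close> for all \<open>i, j\<close>: summands
  other than 1 can be split one at a time, so \<open>p\<^sub>i\<close> is a sum of \<open>m\<close> elements whenever
  \<open>rank p\<^sub>i \<le> m \<le> p\<^sub>i\<close>; for \<open>m\<close> the largest of the ranks, regularity provides a coordinate in
  which the \<open>m\<close> summands are distinct, so that the \<open>m\<close> points are distinct as well.

  Splitting also bounds the ratio of consecutive elements by 2, so the greedy algorithm gives
  \<open>2 ^ rank n \<le> n + 1\<close>. Let \<open>T\<close> be the resulting bound for \<open>rank - 1\<close> on \<open>{1..N}\<close>; then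
  \<open>T < log N / log \<rho>\<close> if \<open>N \<ge> 2\<close>. In a first pass the players announce the running maximum of \<open>rank - 1\<close>.
  Its quotient by \<open>2 ^ b\<close>, where \<open>2 ^ (b + 1) \<le> T < 2 ^ (b + 2)\<close>, increases at most 3 times in
  total and is transmitted in unary by increments, the remainder in binary. In a second pass all
  players but the one who attained the maximum compare it with their own number. This costs
  \<open>k * (b + 2) + T div 2 ^ b - 2\<close> bits, which is below the bound if \<open>k \<ge> 2\<close> and \<open>T \<ge> 2\<close>. For
  \<open>T = 1\<close> there is a protocol with \<open>k + 1\<close> bits, and for \<open>k = 1\<close> or \<open>T = 0\<close> the function is constant.
\<close>

section \<open>Ranks\<close>

lemma represents_ones:
  assumes "1 \<in> A"
  shows "represents A (replicate_mset n 1) n"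
  using assms by (auto simp: represents_def)

lemma rank_in_le: "represents A M n \<Longrightarrow> rank_in A n \<le> size M"
  unfolding rank_in_def by (rule Least_le) blast

lemma rank_in_attained:
  assumes "1 \<in> A"
  obtains M where "represents A M n" "size M = rank_in A n"
proof -
  have "\<exists>l M. represents A M n \<and> size M = l"
    using represents_ones[OF assms] by blast
  from LeastI_ex[OF this] show thesis
    using that unfolding rank_in_def by blast
qed

lemma rank_in_pos:
  assumes "1 \<in> A" "n \<ge> 1"
  shows "rank_in A n \<ge> 1"
proof -
  obtain M where "represents A M n" "size M = rank_in A n"
    using rank_in_attained[OF assms(1)] .
  moreover from this(1) have "M \<noteq> {#}" using assms(2) by (auto simp: represents_def)
  ultimately show ?thesis by (metis One_nat_def Suc_leI nonempty_has_size)
qed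

text \<open>If all summands were 1, the length would equal the sum \<open>n\<close>. So some summand
  differs from 1, and condition (ii) breaks it into two.\<close>

lemma represents_split:
  assumes "admissible \<rho> A" "represents A M n" "size M < n"
  obtains M' where "represents A M' n" "size M' = Suc (size M)"
proof -
  have "\<exists>a\<in>#M. a \<noteq> 1"
  proof (rule ccontr)
    assume "\<not> ?thesis"
    hence "\<Sum>\<^sub># M = (\<Sum>a\<in>#M. 1)"
      using image_mset_cong[of M "\<lambda>a. a" "\<lambda>_. 1"] by simp
    thus False using assms by (simp add: represents_def)
  qed
  then obtain a where a: "a \<in># M" "a \<noteq> 1" by blast
  with assms have "a \<in> A - {1}" by (auto simp: represents_def)
  then obtain x y where xy: "x \<in> A" "y \<in> A" "a = x + y"
    using assms(1) unfolding admissible_def by blast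
  obtain M0 where M0: "M = add_mset a M0" using a(1) by (metis mset_add)
  show thesis
    by (rule that[of "add_mset x (add_mset y M0)"])
       (use assms(2) xy M0 in \<open>auto simp: represents_def\<close>)
qed

lemma represents_length:
  assumes "admissible \<rho> A" "rank_in A n \<le> l" "l \<le> n"
  obtains M where "represents A M n" "size M = l"
proof -
  have "1 \<in> A" using assms(1) by (simp add: admissible_def)
  have "\<exists>M. represents A M n \<and> size M = l"
    using assms(2,3)
  proof (induction l rule: dec_induct)
    case base
    thus ?case using rank_in_attained[OF \<open>1 \<in> A\<close>] by metis
  next
    case (step m)
    then obtain M where "represents A M n" "size M = m" by auto
    thus ?case using represents_split[OF assms(1)] step.prems by (metis Suc_le_lessD)
  qed
  thus thesis using that by blast
qed

section \<open>Distinct summands and the growth of regular sets\<close>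

lemma mult_of_eq_1_imp_count_le:
  assumes "mult_of M = 1"
  shows "count M x \<le> 1"
proof -
  have "finite (range (count M))"
    by (rule finite_subset[of _ "insert 0 (count M ` set_mset M)"])
       (auto simp: image_iff not_in_iff)
  from Max_ge[OF this, of "count M x"] show ?thesis
    using assms unfolding mult_of_def by simp
qed

lemma regular_distinct:
  assumes "regular A" "n \<ge> 1"
  obtains xs where "represents A (mset xs) n" "length xs = rank_in A n" "distinct xs"
proof -
  obtain M where M: "represents A M n" "size M = rank_in A n" "mult_of M = 1"
    using assms unfolding regular_def by blast
  obtain xs where xs: "mset xs = M" using ex_mset by blast
  have "distinct xs"
    unfolding distinct_count_atmost_1
  proof
    fix a
    show "count (mset xs) a = (if a \<in> set xs then 1 else 0)"
      using mult_of_eq_1_imp_count_le[OF M(3), of a] xs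
      by (metis One_nat_def count_eq_zero_iff le_antisym less_one not_le
            set_mset_mset Suc_leI zero_less_iff_neq_zero)
  qed
  thus thesis using that M xs by (metis size_mset)
qed

text \<open>Distinct summands from a finite set never exceed the total sum of that set.\<close>

lemma regular_infinite:
  assumes "regular A"
  shows "infinite A"
proof
  assume fin: "finite A"
  obtain xs where xs: "represents A (mset xs) (Suc (\<Sum>A))" "distinct xs"
    using regular_distinct[OF assms, of "Suc (\<Sum>A)"] by auto
  have "sum_mset (mset xs) = \<Sum>(set xs)"
    using xs(2) sum_list_distinct_conv_sum_set[of xs "\<lambda>x. x"] by (simp add: sum_mset_sum_list)
  also have "\<dots> \<le> \<Sum>A"
    using xs(1) fin by (intro sum_mono2) (auto simp: represents_def)
  finally show False using xs(1) by (simp add: represents_def)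
qed

text \<open>Let \<open>a\<close> be the last element up to \<open>n\<close> and \<open>b\<close> the
  next one. By (ii), \<open>b\<close> is a sum of two elements; these are positive, hence below
  \<open>b\<close>, hence at most \<open>a\<close>. So \<open>n < b \<le> 2 * a\<close>.\<close>

lemma admissible_greedy:
  assumes "admissible \<rho> A" "infinite A" "n \<ge> 1"
  obtains a where "a \<in> A" "a \<le> n" "n < 2 * a"
proof -
  define a where "a = Max {x \<in> A. x \<le> n}"
  have fin: "finite {x \<in> A. x \<le> n}" by simp
  have "1 \<in> {x \<in> A. x \<le> n}" using assms by (simp add: admissible_def)
  hence a: "a \<in> A" "a \<le> n" using Max_in[OF fin] unfolding a_def by blast+
  have le_a: "x \<le> a" if "x \<in> A" "x \<le> n" for x
    unfolding a_def using that fin by simp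
  define b where "b = (LEAST b. b \<in> A \<and> n < b)"
  have "\<exists>b. b \<in> A \<and> n < b" using assms(2) unfolding infinite_nat_iff_unbounded by blast
  from LeastI_ex[OF this] have b: "b \<in> A" "n < b" unfolding b_def by blast+
  have le_n: "x \<le> n" if "x \<in> A" "x < b" for x
    using not_less_Least[of x "\<lambda>b. b \<in> A \<and> n < b"] that unfolding b_def by auto
  have "b \<in> A - {1}" using b assms(3) by auto
  then obtain x y where xy: "x \<in> A" "y \<in> A" "b = x + y"
    using assms(1) unfolding admissible_def by blast
  have "0 \<notin> A" using assms(1) by (simp add: admissible_def)
  with xy have "x \<noteq> 0" "y \<noteq> 0" by metis+
  with xy have "x \<le> a" "y \<le> a" by (auto intro!: le_a le_n)
  with xy(3) b(2) have "n < 2 * a" by linarith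
  with a show thesis using that by blast
qed

text \<open>Removing the greedy summand \<open>a\<close> at least halves \<open>n + 1\<close>: from
  \<open>n < 2 * a\<close> follows \<open>2 * (n - a + 1) \<le> n + 1\<close>.\<close>

lemma rank_in_log_bound:
  assumes "admissible \<rho> A" "regular A"
  shows "2 ^ rank_in A n \<le> n + 1"
proof -
  have "\<exists>M. represents A M n \<and> 2 ^ size M \<le> n + 1"
  proof (induction n rule: less_induct)
    case (less n)
    show ?case
    proof (cases "n = 0")
      case True
      thus ?thesis by (intro exI[of _ "{#}"]) (simp add: represents_def)
    next
      case False
      then obtain a where a: "a \<in> A" "a \<le> n" "n < 2 * a"
        using admissible_greedy[OF assms(1) regular_infinite[OF assms(2)], of n] by auto
      then obtain M where "represents A M (n - a)" "2 ^ size M \<le> n - a + 1"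
        using less[of "n - a"] by auto
      with a show ?thesis
        by (intro exI[of _ "add_mset a M"]) (auto simp: represents_def)
    qed
  qed
  then obtain M where M: "represents A M n" "2 ^ size M \<le> n + 1" by blast
  have "(2::nat) ^ rank_in A n \<le> 2 ^ size M"
    using rank_in_le[OF M(1)] by (intro power_increasing) auto
  with M(2) show ?thesis by linarith
qed


section \<open>Membership in the set of finite sums\<close>

text \<open>The number of points separates the two sides: their \<open>i\<close>-th coordinates
  represent \<open>p $ i\<close> with length \<open>card F\<close>, and each point contributes at
  least 1 to \<open>p $ j\<close>.\<close>

lemma FS_imp_rank_le:
  fixes A :: "'k::finite \<Rightarrow> nat set"
  assumes "\<And>i. 0 \<notin> A i" "p \<in> FS (product_set A)"
  shows "rank_in (A i) (p $ i) \<le> p $ j"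
proof -
  obtain F where F: "finite F" "F \<subseteq> product_set A" "p = \<Sum>F"
    using assms(2) unfolding FS_def by blast
  have p: "p $ l = (\<Sum>x\<in>F. x $ l)" for l using F(3) by simp
  have "represents (A i) (image_mset (\<lambda>x. x $ i) (mset_set F)) (p $ i)"
    using F(1,2) by (auto simp: represents_def p sum_unfold_sum_mset product_set_def)
  hence "rank_in (A i) (p $ i) \<le> card F" using rank_in_le by fastforce
  also have "card F = (\<Sum>x\<in>F. 1)" by simp
  also have "\<dots> \<le> (\<Sum>x\<in>F. x $ j)"
  proof (rule sum_mono)
    fix x assume "x \<in> F"
    hence "x $ j \<in> A j" using F(2) by (auto simp: product_set_def)
    thus "1 \<le> x $ j" using assms(1)[of j] by (cases "x $ j") auto
  qed
  finally show ?thesis by (simp add: p)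
qed

lemma rank_le_imp_FS:
  fixes A :: "'k::finite \<Rightarrow> nat set"
  assumes "\<And>i. admissible \<rho> (A i)" "\<And>i. regular (A i)" "\<And>i. p $ i \<ge> 1"
    and le: "\<And>i j. rank_in (A i) (p $ i) \<le> p $ j"
  shows "p \<in> FS (product_set A)"
proof -
  define R where "R = range (\<lambda>i. rank_in (A i) (p $ i))"
  define r where "r = Max R"
  have "finite R" "R \<noteq> {}" unfolding R_def by auto
  hence "r \<in> R" and rank_le: "\<And>i. rank_in (A i) (p $ i) \<le> r"
    unfolding r_def by (auto simp: R_def)
  then obtain i0 where i0: "r = rank_in (A i0) (p $ i0)" unfolding R_def by blast
  obtain zs where zs: "represents (A i0) (mset zs) (p $ i0)" "length zs = r" "distinct zs"
    using regular_distinct[OF assms(2,3)] i0 by metis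
  have "\<exists>xs. represents (A i) (mset xs) (p $ i) \<and> length xs = r" for i
  proof -
    obtain M where "represents (A i) M (p $ i)" "size M = r"
      using represents_length[OF assms(1) rank_le] le i0 by metis
    thus ?thesis by (metis ex_mset size_mset)
  qed
  then obtain X0 where X0: "\<And>i. represents (A i) (mset (X0 i)) (p $ i)" "\<And>i. length (X0 i) = r"
    by metis
  \<comment> \<open>The distinct entries in coordinate \<open>i0\<close> alone keep the points
    \<open>q l\<close> apart; the other lists may repeat entries.\<close>
  define X where "X = X0(i0 := zs)"
  have X: "represents (A i) (mset (X i)) (p $ i)" "length (X i) = r" for i
    using X0 zs by (auto simp: X_def)
  define q :: "nat \<Rightarrow> nat ^ 'k" where "q l = (\<chi> i. X i ! l)" for l
  have inj: "inj_on q {..<r}"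
  proof (rule inj_onI)
    fix l l' assume l: "l \<in> {..<r}" "l' \<in> {..<r}" "q l = q l'"
    hence "q l $ i0 = q l' $ i0" by simp
    thus "l = l'" using l zs by (simp add: q_def X_def nth_eq_iff_index_eq)
  qed
  have sum: "p = \<Sum>(q ` {..<r})"
  proof (subst vec_eq_iff, rule allI)
    fix i
    have "p $ i = sum_list (X i)" using X(1)[of i] by (simp add: represents_def sum_mset_sum_list)
    also have "\<dots> = (\<Sum>l<r. X i ! l)" by (simp add: sum_list_sum_nth X(2) atLeast0LessThan)
    also have "\<dots> = (\<Sum>l<r. q l) $ i" by (simp add: q_def)
    also have "(\<Sum>l<r. q l) = \<Sum>(q ` {..<r})" by (simp add: sum.reindex[OF inj])
    finally show "p $ i = \<Sum>(q ` {..<r}) $ i" .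
  qed
  have sub: "q ` {..<r} \<subseteq> product_set A"
    using X by (fastforce simp: q_def product_set_def represents_def)
  have "r \<ge> 1"
    unfolding i0 using assms(1,3) by (intro rank_in_pos) (auto simp: admissible_def)
  hence ne: "q ` {..<r} \<noteq> {}" by (auto simp: lessThan_empty_iff)
  have "finite (q ` {..<r})" by simp
  with sum sub ne show ?thesis
    unfolding FS_def mem_Collect_eq by (intro exI[of _ "q ` {..<r}"] conjI)
qed

text \<open>Ranks are at least 1, so the shifted numbers \<open>rank - 1\<close> start at 0 and lose
  no information.\<close>

lemma FS_member_eq:
  fixes A :: "'k::finite \<Rightarrow> nat set"
  assumes "\<And>i. admissible \<rho> (A i)" "\<And>i. regular (A i)" "\<And>i. p $ i \<ge> 1"
  shows "FS_member A p = of_bool (\<forall>i j. rank_in (A i) (p $ i) - 1 < p $ j)"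
proof -
  have "rank_in (A i) (p $ i) - 1 < p $ j \<longleftrightarrow> rank_in (A i) (p $ i) \<le> p $ j" for i j
    using rank_in_pos[of "A i" "p $ i"] assms(1)[of i] assms(3)[of i]
    by (auto simp: admissible_def)
  moreover have "p \<in> FS (product_set A) \<longleftrightarrow> (\<forall>i j. rank_in (A i) (p $ i) \<le> p $ j)"
  proof
    assume "p \<in> FS (product_set A)"
    moreover have "0 \<notin> A i" for i using assms(1) by (simp add: admissible_def)
    ultimately show "\<forall>i j. rank_in (A i) (p $ i) \<le> p $ j" using FS_imp_rank_le by blast
  next
    assume "\<forall>i j. rank_in (A i) (p $ i) \<le> p $ j"
    thus "p \<in> FS (product_set A)"
      by (intro rank_le_imp_FS[OF assms]) blast
  qed
  ultimately show ?thesis by (simp only: FS_member_def of_bool_def)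
qed


section \<open>Protocols\<close>

lemma CC_le:
  assumes "computes P D F" "\<And>x. x \<in> inputs D \<Longrightarrow> bits_written P x \<le> n"
  shows "CC D F \<le> enat n"
proof -
  have "CC D F \<le> (SUP x\<in>inputs D. enat (bits_written P x))"
    unfolding CC_def using assms(1) by (intro INF_lower) simp
  also have "\<dots> \<le> enat n" using assms(2) by (intro SUP_least) simp
  finally show ?thesis .
qed

section \<open>Transmitting a single number\<close>

text \<open>\<open>K\<close> is a continuation: it receives the value decoded from the blackboard,
  so the rest of the protocol depends on the bits written and not on the input itself. The lowest
  bit comes first.\<close>

primrec tell_binary ::
    "nat \<Rightarrow> 'k \<Rightarrow> ('x \<Rightarrow> nat) \<Rightarrow> (nat \<Rightarrow> ('k, 'x, 'o) protocol) \<Rightarrow> ('k, 'x, 'o) protocol" where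
  "tell_binary 0 j f K = K 0"
| "tell_binary (Suc b) j f K = Write j (\<lambda>x. odd (f x))
     (tell_binary b j (\<lambda>x. f x div 2) (\<lambda>v. K (2 * v + 1)))
     (tell_binary b j (\<lambda>x. f x div 2) (\<lambda>v. K (2 * v)))"

lemma tell_binary:
  assumes "f (x $ j) < 2 ^ b"
  shows "conclusion (tell_binary b j f K) x i = conclusion (K (f (x $ j))) x i"
    and "bits_written (tell_binary b j f K) x = b + bits_written (K (f (x $ j))) x"
proof -
  have "conclusion (tell_binary b j f K) x i = conclusion (K (f (x $ j))) x i \<and>
        bits_written (tell_binary b j f K) x = b + bits_written (K (f (x $ j))) x"
    using assms
  proof (induction b arbitrary: f K)
    case (Suc b)
    have "f (x $ j) div 2 < 2 ^ b" using Suc.prems by (simp add: less_mult_imp_div_less mult.commute)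
    note IH = Suc.IH[of "\<lambda>x. f x div 2", OF this]
    show ?case
      using IH by (cases "odd (f (x $ j))") (simp_all add: odd_two_times_div_two_succ)
  qed simp
  thus "conclusion (tell_binary b j f K) x i = conclusion (K (f (x $ j))) x i"
    and "bits_written (tell_binary b j f K) x = b + bits_written (K (f (x $ j))) x" by blast+
qed

text \<open>The terminating 0 is omitted when the value is the maximal one \<open>n\<close>.\<close>

primrec tell_unary ::
    "nat \<Rightarrow> 'k \<Rightarrow> ('x \<Rightarrow> nat) \<Rightarrow> (nat \<Rightarrow> ('k, 'x, 'o) protocol) \<Rightarrow> ('k, 'x, 'o) protocol" where
  "tell_unary 0 j f K = K 0"
| "tell_unary (Suc n) j f K = Write j (\<lambda>x. f x > 0)
     (tell_unary n j (\<lambda>x. f x - 1) (\<lambda>v. K (Suc v))) (K 0)"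

lemma tell_unary:
  assumes "f (x $ j) \<le> n"
  shows "conclusion (tell_unary n j f K) x i = conclusion (K (f (x $ j))) x i"
    and "bits_written (tell_unary n j f K) x =
           f (x $ j) + of_bool (f (x $ j) < n) + bits_written (K (f (x $ j))) x"
proof -
  have "conclusion (tell_unary n j f K) x i = conclusion (K (f (x $ j))) x i \<and>
        bits_written (tell_unary n j f K) x =
           f (x $ j) + of_bool (f (x $ j) < n) + bits_written (K (f (x $ j))) x"
    using assms
  proof (induction n arbitrary: f K)
    case (Suc n)
    have "f (x $ j) - 1 \<le> n" using Suc.prems by simp
    note IH = Suc.IH[of "\<lambda>x. f x - 1", OF this]
    show ?case
      using IH by (cases "f (x $ j)") simp_all
  qed simp
  thus "conclusion (tell_unary n j f K) x i = conclusion (K (f (x $ j))) x i"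
    and "bits_written (tell_unary n j f K) x =
           f (x $ j) + of_bool (f (x $ j) < n) + bits_written (K (f (x $ j))) x" by blast+
qed

primrec check_all :: "('k \<Rightarrow> 'x \<Rightarrow> bool) \<Rightarrow> 'k list \<Rightarrow> ('k, 'x, nat) protocol" where
  "check_all C [] = Stop (\<lambda>_ _. 1)"
| "check_all C (j # js) = Write j (C j) (check_all C js) (Stop (\<lambda>_ _. 0))"

lemma conclusion_check_all:
  "conclusion (check_all C js) x i = of_bool (\<forall>j\<in>set js. C j (x $ j))"
  by (induction js) auto

lemma bits_written_check_all: "bits_written (check_all C js) x \<le> length js"
  by (induction js) auto

section \<open>Two-pass protocol with a running maximum\<close>

text \<open>
  Here \<open>m\<close> is the running maximum of the \<open>g j\<close>, and \<open>s\<close> is a player known to satisfy \<open>m < v s\<close>,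
  who can therefore remain silent in the second pass.
\<close>

primrec max_protocol ::
    "('k \<Rightarrow> 'x \<Rightarrow> nat) \<Rightarrow> ('k \<Rightarrow> 'x \<Rightarrow> nat) \<Rightarrow> 'k list \<Rightarrow> nat \<Rightarrow> nat \<Rightarrow>
     'k list \<Rightarrow> 'k \<Rightarrow> nat \<Rightarrow> ('k, 'x, nat) protocol" where
  "max_protocol g v ps T b [] s m = check_all (\<lambda>j x. m < v j x) (remove1 s ps)"
| "max_protocol g v ps T b (j # js) s m =
     tell_unary (T div 2 ^ b - m div 2 ^ b) j (\<lambda>x. max m (g j x) div 2 ^ b - m div 2 ^ b) (\<lambda>u.
       tell_binary b j (\<lambda>x. max m (g j x) mod 2 ^ b) (\<lambda>w.
         let m' = (m div 2 ^ b + u) * 2 ^ b + w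
         in max_protocol g v ps T b js (if m < m' then j else s) m'))"

lemma max_protocol_Cons:
  fixes v :: "'k::finite \<Rightarrow> 'x \<Rightarrow> nat" and ps js :: "'k list" and s :: 'k and b :: nat
  assumes "m \<le> T" "g j (x $ j) \<le> T"
  defines "m' \<equiv> max m (g j (x $ j))"
  defines "P' \<equiv> max_protocol g v ps T b js (if m < m' then j else s) m'"
  shows "conclusion (max_protocol g v ps T b (j # js) s m) x i = conclusion P' x i"
    and "bits_written (max_protocol g v ps T b (j # js) s m) x =
           (m' div 2 ^ b - m div 2 ^ b) + of_bool (m' div 2 ^ b < T div 2 ^ b) + b + bits_written P' x"
proof -
  have le: "m div 2 ^ b \<le> m' div 2 ^ b" "m' div 2 ^ b \<le> T div 2 ^ b"
    using assms by (auto intro!: div_le_mono)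
  have eq: "(m div 2 ^ b + (m' div 2 ^ b - m div 2 ^ b)) * 2 ^ b + m' mod 2 ^ b = m'"
    using le by (simp add: div_mult_mod_eq)
  have less: "m' div 2 ^ b - m div 2 ^ b < T div 2 ^ b - m div 2 ^ b \<longleftrightarrow> m' div 2 ^ b < T div 2 ^ b"
    using le by linarith
  show "conclusion (max_protocol g v ps T b (j # js) s m) x i = conclusion P' x i"
    using le eq by (simp add: tell_unary tell_binary P'_def m'_def Let_def)
  show "bits_written (max_protocol g v ps T b (j # js) s m) x =
         (m' div 2 ^ b - m div 2 ^ b) + of_bool (m' div 2 ^ b < T div 2 ^ b) + b + bits_written P' x"
    using le eq less by (simp add: tell_unary tell_binary P'_def m'_def Let_def add.assoc)
qed

text \<open>The invariant \<open>m < v s (x $ s)\<close> justifies the silence of \<open>s\<close>: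
  whoever raises the maximum takes over the role of \<open>s\<close>, and its own \<open>g\<close>
  lies below its own \<open>v\<close>.\<close>

lemma conclusion_max_protocol:
  fixes x :: "'x ^ 'k::finite"
  assumes "set ps = UNIV" "distinct ps" "m \<le> T" "m < v s (x $ s)"
    and "\<And>j. g j (x $ j) \<le> T" "\<And>j. g j (x $ j) < v j (x $ j)"
  shows "conclusion (max_protocol g v ps T b js s m) x i =
           of_bool ((\<forall>l. m < v l (x $ l)) \<and> (\<forall>j\<in>set js. \<forall>l. g j (x $ j) < v l (x $ l)))"
  using assms(3,4)
proof (induction js arbitrary: s m)
  case Nil
  thus ?case using assms(1,2) by (auto simp: conclusion_check_all)
next
  case (Cons j js)
  have "max m (g j (x $ j)) \<le> T" using Cons.prems assms(5) by simp
  moreover have "max m (g j (x $ j)) < v s' (x $ s')"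
    if "s' = (if m < max m (g j (x $ j)) then j else s)" for s'
    using that Cons.prems assms(6)[of j] by (auto split: if_splits)
  ultimately show ?case
    by (subst max_protocol_Cons(1)[where g=g and j=j, OF Cons.prems(1) assms(5)], subst Cons.IH) auto
qed

text \<open>The increments of the quotient telescope. Each player pays \<open>b\<close> bits and at
  most one terminating 0. Either the quotient stays below its maximum, or the player reaching it
  omits the 0; both save one bit, unless the quotient was maximal from the start.\<close>

lemma bits_written_max_protocol:
  fixes x :: "'x ^ 'k::finite"
  assumes "set ps = UNIV" "distinct ps" "m \<le> T" "\<And>j. g j (x $ j) \<le> T"
  shows "bits_written (max_protocol g v ps T b js s m) x \<le>
           length js * (b + 1) + (T div 2 ^ b - m div 2 ^ b - 1) + (CARD('k) - 1)"
  using assms(3)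
proof (induction js arbitrary: s m)
  case Nil
  have "length (remove1 s ps) = CARD('k) - 1"
    using assms(1,2) by (metis UNIV_I distinct_card length_remove1)
  thus ?case using bits_written_check_all[of "\<lambda>j x. m < v j x" "remove1 s ps" x] by simp
next
  case (Cons j js)
  define m' where "m' = max m (g j (x $ j))"
  have m': "m' \<le> T" using Cons.prems assms(4) by (simp add: m'_def)
  have le: "m div 2 ^ b \<le> m' div 2 ^ b" "m' div 2 ^ b \<le> T div 2 ^ b"
    using m' by (auto intro!: div_le_mono simp: m'_def)
  have "(c - a) + of_bool (c < q) + b + B \<le> Suc n * (b + 1) + (q - a - 1) + K"
    if "B \<le> n * (b + 1) + (q - c - 1) + K" "a \<le> c" "c \<le> q" for a c q n B K
  proof -
    have "Suc n * (b + 1) = n * (b + 1) + b + 1" by simp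
    moreover have "(c - a) + of_bool (c < q) + (q - c - 1) \<le> q - a - 1 + 1"
      using that(2,3) by (auto simp: of_bool_def)
    ultimately show ?thesis using that(1) by linarith
  qed
  from this[OF Cons.IH[OF m'] le] show ?case
    unfolding max_protocol_Cons(2)[where g=g and j=j and js=js, OF Cons.prems assms(4)]
    by (simp only: m'_def list.size(4) add_0_right add_Suc_right)
qed

lemma CC_max_protocol:
  fixes F :: "'x ^ 'k::finite \<Rightarrow> nat"
  assumes F: "\<And>x. x \<in> inputs D \<Longrightarrow> F x = of_bool (\<forall>i j. g i (x $ i) < v j (x $ j))"
    and g: "\<And>i x. x \<in> D i \<Longrightarrow> g i x \<le> T" "\<And>i x. x \<in> D i \<Longrightarrow> g i x < v i x"
    and "T div 2 ^ b \<ge> 1"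
  shows "CC D F \<le> enat (CARD('k) * (b + 2) + T div 2 ^ b - 2)"
proof -
  obtain ps :: "'k list" where ps: "set ps = UNIV" "distinct ps"
    using finite_distinct_list[OF finite] by blast
  hence len: "length ps = CARD('k)" by (metis distinct_card)
  \<comment> \<open>Any player may start as the silent one, since \<open>m = 0\<close> and all
    \<open>v\<close> are positive.\<close>
  define P where "P = max_protocol g v ps T b ps (hd ps) 0"
  show ?thesis
  proof (rule CC_le[of P])
    show "computes P D F"
      unfolding computes_def
    proof (intro ballI allI)
      fix x i assume x: "x \<in> inputs D"
      hence D: "x $ j \<in> D j" for j by (simp add: inputs_def)
      have pos: "0 < v l (x $ l)" for l using g(2)[OF D[of l]] by simp
      show "conclusion P x i = F x"
        unfolding P_def F[OF x] using ps g D pos by (subst conclusion_max_protocol) auto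
    qed
  next
    fix x assume "x \<in> inputs D"
    hence "g j (x $ j) \<le> T" for j using g by (simp add: inputs_def)
    from bits_written_max_protocol[where m=0 and g=g and v=v and js=ps and b=b, OF ps _ this]
    have "bits_written P x \<le> CARD('k) * (b + 1) + (T div 2 ^ b - 1) + (CARD('k) - 1)"
      by (simp add: P_def len)
    also have "\<dots> = CARD('k) * (b + 2) + T div 2 ^ b - 2"
      using assms(4) zero_less_card_finite[where 'a='k] by (simp add: algebra_simps)
    finally show "bits_written P x \<le> CARD('k) * (b + 2) + T div 2 ^ b - 2" .
  qed
qed

section \<open>Protocol for ranks at most 2\<close>

text \<open>
  For \<open>g \<le> 1\<close>, only players with \<open>g = 1\<close> and players with \<open>v = 1\<close> can be in conflict. The first
  player of either kind writes an additional bit to tell which kind it is.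
\<close>

primrec binary_protocol ::
    "('k \<Rightarrow> 'x \<Rightarrow> nat) \<Rightarrow> ('k \<Rightarrow> 'x \<Rightarrow> nat) \<Rightarrow> 'k list \<Rightarrow> ('k, 'x, nat) protocol" where
  "binary_protocol g v [] = Stop (\<lambda>_ _. 1)"
| "binary_protocol g v (j # js) = Write j (\<lambda>x. g j x = 0 \<and> 1 < v j x)
     (binary_protocol g v js)
     (Write j (\<lambda>x. g j x = 0)
       (check_all (\<lambda>j x. g j x = 0) js)
       (check_all (\<lambda>j x. 1 < v j x) js))"

text \<open>Neutral players conflict with nobody. Once a player with \<open>v = 1\<close> is known,
  success means that all \<open>g\<close> vanish; once one with \<open>g = 1\<close> is known, it
  means that all \<open>v\<close> exceed 1.\<close>

lemma conclusion_binary_protocol: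
  assumes "\<And>j. g j (x $ j) \<le> 1" "\<And>j. g j (x $ j) < v j (x $ j)"
  shows "conclusion (binary_protocol g v js) x i =
           of_bool (\<forall>i\<in>set js. \<forall>j\<in>set js. g i (x $ i) < v j (x $ j))"
proof (induction js)
  case (Cons j js)
  have g: "g l (x $ l) = 0 \<or> g l (x $ l) = 1" and v: "0 < v l (x $ l)" for l
    using assms[of l] by auto
  \<comment> \<open>\<open>g = v = 1\<close> cannot occur, because \<open>g < v\<close> for each
    single player.\<close>
  consider (neutral) "g j (x $ j) = 0" "1 < v j (x $ j)" | (low) "g j (x $ j) = 0" "v j (x $ j) = 1"
    | (high) "g j (x $ j) = 1" "1 < v j (x $ j)"
    using g[of j] assms(2)[of j] by fastforce
  thus ?case
  proof cases
    case neutral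
    moreover have "g l (x $ l) < v j (x $ j)" for l using neutral assms(1)[of l] by simp
    ultimately show ?thesis using Cons v by simp
  next
    case low
    moreover have "0 < g l (x $ l)" if "\<not> g l (x $ l) < v l' (x $ l')" for l l'
      using that v[of l'] by linarith
    moreover have "v l (x $ l) \<noteq> 0" for l using v[of l] by simp
    ultimately show ?thesis by (auto simp: conclusion_check_all)
  next
    case high
    moreover have "g l (x $ l) < v l' (x $ l')" if "1 < v l' (x $ l')" for l l'
      using that assms(1)[of l] by simp
    ultimately show ?thesis by (auto simp: conclusion_check_all)
  qed
qed simp

lemma bits_written_binary_protocol: "bits_written (binary_protocol g v js) x \<le> length js + 1"
proof (induction js)
  case (Cons j js)
  thus ?case using bits_written_check_all[of _ js x] by simp
qed simp

lemma CC_binary_protocol: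
  fixes F :: "'x ^ 'k::finite \<Rightarrow> nat" and g v :: "'k \<Rightarrow> 'x \<Rightarrow> nat"
  assumes F: "\<And>x. x \<in> inputs D \<Longrightarrow> F x = of_bool (\<forall>i j. g i (x $ i) < v j (x $ j))"
    and g: "\<And>i x. x \<in> D i \<Longrightarrow> g i x \<le> 1" "\<And>i x. x \<in> D i \<Longrightarrow> g i x < v i x"
  shows "CC D F \<le> enat (CARD('k) + 1)"
proof -
  obtain ps :: "'k list" where ps: "set ps = UNIV" "distinct ps"
    using finite_distinct_list[OF finite] by blast
  hence len: "length ps = CARD('k)" by (metis distinct_card)
  show ?thesis
  proof (rule CC_le[of "binary_protocol g v ps"])
    show "computes (binary_protocol g v ps) D F"
      unfolding computes_def
    proof (intro ballI allI)
      fix x i assume x: "x \<in> inputs D"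
      hence "x $ j \<in> D j" for j by (simp add: inputs_def)
      thus "conclusion (binary_protocol g v ps) x i = F x"
        unfolding F[OF x] using ps g by (subst conclusion_binary_protocol) auto
    qed
  next
    fix x
    show "bits_written (binary_protocol g v ps) x \<le> CARD('k) + 1"
      using bits_written_binary_protocol[of g v ps x] len by simp
  qed
qed

lemma CC_constant:
  assumes "\<And>x. x \<in> inputs D \<Longrightarrow> F x = c"
  shows "CC D F \<le> enat 0"
  by (rule CC_le[of "Stop (\<lambda>_ _. c)"]) (auto simp: computes_def assms)


section \<open>The upper bound\<close>

text \<open>With \<open>g\<close> for \<open>rank - 1\<close> and \<open>v\<close> for the
  coordinate, this covers both fixed sets and sets that belong to the input.\<close>

lemma CC_bound:
  fixes F :: "'x ^ 'k::finite \<Rightarrow> nat" and \<rho> :: real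
  assumes F: "\<And>x. x \<in> inputs D \<Longrightarrow> F x = of_bool (\<forall>i j. g i (x $ i) < v j (x $ j))"
    and g: "\<And>i x. x \<in> D i \<Longrightarrow> 2 ^ (g i x + 1) \<le> N + 1" "\<And>i x. x \<in> D i \<Longrightarrow> g i x < v i x"
    and N: "N \<ge> 1" and \<rho>: "1 < \<rho>" "\<rho> \<le> 2"
  shows "ereal_of_enat (CC D F)
           < ereal (real CARD('k) * log 2 (log 2 (real N) / log 2 \<rho>) + real CARD('k))"
proof -
  define k where "k = CARD('k)"
  have k: "k \<ge> 1" unfolding k_def by (simp add: Suc_leI)
  define L where "L = log 2 (real N) / log 2 \<rho>"
  have "0 < log 2 \<rho>" "log 2 \<rho> \<le> 1" using \<rho> by auto
  hence L: "log 2 (real N) \<le> L"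
    unfolding L_def using N by (simp add: le_divide_eq mult_left_le)
  have L_ge_1: "L \<ge> 1" if "N \<ge> 2"
  proof -
    have "1 \<le> log 2 (real N)" using that by (subst le_log_iff) auto
    thus ?thesis using L by simp
  qed
  have bound: ?thesis if "CC D F \<le> enat n" "real n < real k * log 2 L + real k" for n
  proof -
    have "ereal_of_enat (CC D F) \<le> ereal (real n)"
      using that(1) by (metis ereal_of_enat_le_iff ereal_of_enat_simps(1))
    also have "\<dots> < ereal (real k * log 2 L + real k)" using that(2) by simp
    finally show ?thesis by (simp add: k_def L_def)
  qed
  have "0 \<le> log 2 L"
    \<comment> \<open>for \<open>N = 1\<close> because \<open>log 2 0 = 0\<close>\<close>
    using L_ge_1 N by (cases "N = 1") (auto simp: L_def log_def)
  hence pos: "0 < real k * log 2 L + real k" using k by (intro add_nonneg_pos) auto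
  have const: ?thesis if "\<And>x. x \<in> inputs D \<Longrightarrow> F x = 1"
    using CC_constant[of D F 1, OF that] pos by (intro bound[of 0]) auto
  \<comment> \<open>\<open>T + 1\<close> is the integer part of the binary logarithm of
    \<open>N + 1\<close>; it is positive as \<open>N \<ge> 1\<close>.\<close>
  obtain T where T: "2 ^ (T + 1) \<le> N + 1" "N + 1 < 2 ^ (T + 2)"
  proof -
    obtain n where n: "2 ^ n \<le> N + 1" "N + 1 < 2 ^ (n + 1)"
      using ex_power_ivl1[of 2 "N + 1"] by auto
    with N have "n \<noteq> 0" by (intro notI) simp
    thus thesis using n that[of "n - 1"] by simp
  qed
  have gT: "g i x \<le> T" if "x \<in> D i" for i x
  proof -
    have "(2::nat) ^ (g i x + 1) < 2 ^ (T + 2)" using g(1)[OF that] T(2) by linarith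
    thus ?thesis by (subst (asm) power_strict_increasing_iff) auto
  qed
  consider "k = 1" | "T = 0" | "k \<ge> 2" "T = 1" | "k \<ge> 2" "T \<ge> 2" using k by linarith
  thus ?thesis
  proof cases
    case 1
    hence eq: "i = j" for i j :: 'k
      unfolding k_def by (metis card_1_singletonE UNIV_I singletonD)
    show ?thesis
    proof (rule const)
      fix x assume x: "x \<in> inputs D"
      hence "g i (x $ i) < v j (x $ j)" for i j
        using g(2)[of "x $ i" i] eq[of j i] by (simp add: inputs_def)
      thus "F x = 1" using F[OF x] by simp
    qed
  next
    case 2
    show ?thesis
    proof (rule const)
      fix x assume x: "x \<in> inputs D"
      have "g i (x $ i) < v j (x $ j)" for i j
        using g(2)[of "x $ j" j] gT[of "x $ i" i] 2 x by (simp add: inputs_def)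
      thus "F x = 1" using F[OF x] by simp
    qed
  next
    case 3
    have "N \<ge> 3" using T(1) 3 by simp
    \<comment> \<open>The target \<open>k + 1\<close> requires \<open>k * log 2 L > 1\<close>. For
      \<open>k \<ge> 2\<close> it suffices that \<open>L > 3 / 2\<close>, which comes from 9 >
      8.\<close>
    have "(3 / 2 :: real) = log 2 8 / 2" using log_nat_power[of 2 2 3] by simp
    also have "\<dots> < log 2 (3\<^sup>2) / 2" by (intro divide_strict_right_mono) auto
    also have "\<dots> = log 2 3" by (subst log_nat_power) auto
    also have "\<dots> \<le> log 2 (real N)" using \<open>N \<ge> 3\<close> by simp
    finally have "3 / 2 < L" using L by linarith
    hence "2 < L\<^sup>2" using power_strict_mono[of "3/2" L 2] by (simp add: power2_eq_square)
    moreover have "L > 0" using \<open>3 / 2 < L\<close> by simp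
    ultimately have "log 2 (2::real) < log 2 (L\<^sup>2)" by (subst log_less_cancel_iff) auto
    hence "1 < 2 * log 2 L" using \<open>L > 0\<close> by (simp add: log_nat_power)
    also have "\<dots> \<le> real k * log 2 L" using 3 \<open>0 \<le> log 2 L\<close> by (intro mult_right_mono) auto
    finally show ?thesis
      using CC_binary_protocol[of D F g v, OF F] gT g(2) 3
      by (intro bound[of "k + 1"]) (auto simp: k_def)
  next
    case 4
    \<comment> \<open>\<open>2 ^ T \<le> N + 1 - 2 ^ T < N\<close>, as \<open>2 ^ T \<ge> 2\<close>.
      The resulting \<open>T < L\<close> makes the final bound strict.\<close>
    have "(2::nat) ^ T < N" using T(1) N 4 power_increasing[of 1 T "2::nat"] by simp
    hence "real T < log 2 (real N)" by (rule less_log2_of_power)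
    hence TL: "real T < L" using L by simp
    \<comment> \<open>This choice leaves only 2 and 3 as values of the top quotient
      \<open>Q\<close>.\<close>
    obtain b where b: "2 ^ (b + 1) \<le> T" "T < 2 ^ (b + 2)"
    proof -
      obtain n where n: "2 ^ n \<le> T" "T < 2 ^ (n + 1)"
        using ex_power_ivl1[of 2 T] 4 by auto
      with 4 have "n \<noteq> 0" by (intro notI) simp
      thus thesis using n that[of "n - 1"] by simp
    qed
    define Q where "Q = T div 2 ^ b"
    have "Q \<ge> 2" unfolding Q_def using b(1) by (subst less_eq_div_iff_mult_less_eq) auto
    moreover have "Q < 4" unfolding Q_def using b(2) by (intro less_mult_imp_div_less) auto
    ultimately have Q: "Q = 2 \<or> Q = 3" by linarith
    \<comment> \<open>The cost beyond \<open>k * (b + 1)\<close> is \<open>k + Q - 2\<close>, to be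
      covered by \<open>k * log 2 Q\<close>. For \<open>Q = 2\<close> there is equality; for
      \<open>Q = 3\<close> the assumption \<open>k \<ge> 2\<close> enters.\<close>
    have "(2::nat) ^ (n + 1) \<le> 3 ^ n" if "n \<ge> 2" for n
      using that by (induction n rule: dec_induct) auto
    hence "2 ^ (k + Q - 2) \<le> Q ^ k" using Q 4(1) by auto
    hence "real (k + Q - 2) \<le> log 2 (real (Q ^ k))" by (rule le_log2_of_power)
    also have "\<dots> = real k * log 2 Q" using Q by (auto simp: log_nat_power)
    finally have "real (k * (b + 2) + Q - 2) \<le> real k * (log 2 Q + real b) + real k"
      using Q by (auto simp: algebra_simps of_nat_diff)
    also have "log 2 Q + real b = log 2 (real (Q * 2 ^ b))"
      using Q by (auto simp: log_mult log_nat_power)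
    also have "real k * \<dots> < real k * log 2 L"
    proof -
      have "real (Q * 2 ^ b) \<le> real T" unfolding Q_def by (subst of_nat_le_iff) simp
      hence "real (Q * 2 ^ b) < L" using TL by linarith
      thus ?thesis using Q k by (intro mult_strict_left_mono log_less) auto
    qed
    finally show ?thesis
      using CC_max_protocol[of D F g v T b, OF F gT g(2)] Q
      by (intro bound[of "k * (b + 2) + Q - 2"]) (auto simp: k_def Q_def)
  qed
qed

theorem theorem1p3:
  fixes A :: "'k::finite \<Rightarrow> nat set" and N :: nat and \<rho> :: real
  assumes "N \<ge> 1"
    and "1 < \<rho>" and "\<rho> \<le> 2"
    and "\<And>i. admissible \<rho> (A i)"
    and "\<And>i. regular (A i)"
  shows "ereal_of_enat (CC (\<lambda>i::'k. {1..N}) (FS_member A))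
           < ereal (real CARD('k) * log 2 (log 2 (real N) / log 2 \<rho>) + real CARD('k)) \<and>
         ereal_of_enat (CC (\<lambda>i::'k. set_point_inputs \<rho> N) FS_member_joint)
           < ereal (real CARD('k) * log 2 (log 2 (real N) / log 2 \<rho>) + real CARD('k))"
proof -
  have rank: "2 ^ (rank_in B n - 1 + 1) \<le> N + 1" "rank_in B n - 1 < n"
    if "admissible \<rho> B" "regular B" "1 \<le> n" "n \<le> N" for B n
  proof -
    have "1 \<in> B" using that by (simp add: admissible_def)
    hence "rank_in B n \<ge> 1" "rank_in B n \<le> n"
      using rank_in_pos that rank_in_le[OF represents_ones, of B n] by auto
    thus "2 ^ (rank_in B n - 1 + 1) \<le> N + 1" "rank_in B n - 1 < n"
      using rank_in_log_bound[OF that(1,2), of n] that(4) by auto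
  qed
  show ?thesis
  proof
    show "ereal_of_enat (CC (\<lambda>i::'k. {1..N}) (FS_member A))
           < ereal (real CARD('k) * log 2 (log 2 (real N) / log 2 \<rho>) + real CARD('k))"
      by (rule CC_bound[where g="\<lambda>i p. rank_in (A i) p - 1" and v="\<lambda>_ p. p"])
         (use assms rank in \<open>simp_all add: inputs_def FS_member_eq[where \<rho>=\<rho>]\<close>)
    have member: "FS_member_joint q =
        of_bool (\<forall>i j. rank_in (fst (q $ i)) (snd (q $ i)) - 1 < snd (q $ j))"
      if "q \<in> inputs (\<lambda>i::'k. set_point_inputs \<rho> N)" for q
    proof -
      have q: "admissible \<rho> (fst (q $ i))" "regular (fst (q $ i))" "1 \<le> snd (q $ i)" for i
        using that by (auto simp: inputs_def set_point_inputs_def mem_Times_iff)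
      show ?thesis
        unfolding FS_member_joint_def using q by (subst FS_member_eq[where \<rho>=\<rho>]) auto
    qed
    \<comment> \<open>Here \<open>g\<close> and \<open>v\<close> read the set off the player's own
      input, so one protocol serves all choices of sets.\<close>
    show "ereal_of_enat (CC (\<lambda>i::'k. set_point_inputs \<rho> N) FS_member_joint)
           < ereal (real CARD('k) * log 2 (log 2 (real N) / log 2 \<rho>) + real CARD('k))"
      by (rule CC_bound[where g="\<lambda>_ z. rank_in (fst z) (snd z) - 1" and v="\<lambda>_. snd"])
         (use assms(1-3) rank member in \<open>auto simp: set_point_inputs_def\<close>)
  qed
qed

end
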